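(* Let $\mathcal{A}$ be a $C^*$-algebra with unit $1$, let $n\ge 2$, and let $(P_1,\dots,P_n)$ be an $n$-tuple of non-trivial projections in $\mathcal{A}$. Let $\epsilon\in(0,1)$. If $\|P_iP_j\|<\delta=\dfrac{\epsilon}{2(n-1)}$ for all $1\le i<j\le n$, then there are mutually orthogonal projections $P_1',\dots,P_n'\in\mathcal{A}$ such that $\|P_i-P_i'\|<\epsilon$ for $i=1,\dots,n$.
   Context: A projection in $\mathcal{A}$ is an element $P$ with $P=P^*=P^2$; it is non-trivial if $P\ne0$ and $P\ne1$. Projections $P_1',\dots,P_n'$ are mutually orthogonal if $P_i'P_j'=0$ for $i\ne j$. *)

theory Defs
  imports "HOL-Analysis.Analysis"
begin

text \<open>
  Unital C*-algebras over the complex numbers. The ring structure, the unit, the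
  submultiplicative norm and completeness come from the library classes; \<open>scaleC_of_real\<close>
  makes the complex scalar multiplication extend the real one of those classes.
  The class \<open>real_normed_algebra_1\<close> includes \<open>norm 1 = 1\<close>. This is a consequence of the
  C*-identity as soon as \<open>1 \<noteq> 0\<close>, so only the zero algebra is left out.
\<close>

class unital_cstar_algebra = real_normed_algebra_1 + banach +
  fixes scaleC :: "complex \<Rightarrow> 'a \<Rightarrow> 'a"
    and star :: "'a \<Rightarrow> 'a"
  assumes scaleC_add_right: "scaleC c (x + y) = scaleC c x + scaleC c y"
    and scaleC_add_left: "scaleC (c + d) x = scaleC c x + scaleC d x"
    and scaleC_scaleC: "scaleC c (scaleC d x) = scaleC (c * d) x"
    and scaleC_of_real: "scaleC (complex_of_real r) x = r *\<^sub>R x"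
    and mult_scaleC_left: "scaleC c x * y = scaleC c (x * y)"
    and mult_scaleC_right: "x * scaleC c y = scaleC c (x * y)"
    and norm_scaleC: "norm (scaleC c x) = cmod c * norm x"
    and star_star: "star (star x) = x"
    and star_add: "star (x + y) = star x + star y"
    and star_scaleC: "star (scaleC c x) = scaleC (cnj c) (star x)"
    and star_mult: "star (x * y) = star y * star x"
    and cstar_identity: "norm (star x * x) = (norm x)\<^sup>2"

definition is_projection :: "'a::unital_cstar_algebra \<Rightarrow> bool" where
  "is_projection p \<longleftrightarrow> star p = p \<and> p * p = p"

definition nontrivial_projection :: "'a::unital_cstar_algebra \<Rightarrow> bool" where
  "nontrivial_projection p \<longleftrightarrow> is_projection p \<and> p \<noteq> 0 \<and> p \<noteq> 1"

definition mutually_orthogonal :: "'i set \<Rightarrow> ('i \<Rightarrow> 'a::unital_cstar_algebra) \<Rightarrow> bool" where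
  "mutually_orthogonal I p \<longleftrightarrow> (\<forall>i\<in>I. \<forall>j\<in>I. i \<noteq> j \<longrightarrow> p i * p j = 0)"

end

theory Submission
  imports Defs
begin

text \<open>
  Gram--Schmidt orthogonalisation, which needs only a Neumann series and no functional calculus.
  If \<open>R\<close> is the sum of the projections already constructed and \<open>x = P R P\<close> has norm below 1,
  then \<open>P' = (1 - R) P (1 - x)\<inverse> P (1 - R)\<close> is a projection orthogonal to \<open>R\<close>;
  in a representation it projects onto the range of \<open>(1 - R) P\<close>.
  Both \<open>\<parallel>P - P'\<parallel>\<close> and the overlap of \<open>R + P'\<close> with the remaining projections are controlled
  by \<open>\<parallel>R P\<parallel>\<close>. With \<open>\<parallel>P\<^sub>i P\<^sub>j\<parallel> \<le> \<delta>\<close>, the squared overlap \<open>s\<^sub>k\<close> after \<open>k\<close> steps satisfies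
  \<open>s\<^sub>k\<^sub>+\<^sub>1 \<le> s\<^sub>k + (\<delta> + s\<^sub>k)\<^sup>2 / (1 - s\<^sub>k)\<close>, a recursion solved exactly by
  \<open>s\<^sub>k = k \<delta>\<^sup>2 / (1 - (k - 1) \<delta>)\<close>. For \<open>k < n\<close> this is at most \<open>\<epsilon>\<^sup>2 / 4\<close>.
\<close>

lemma neumann_inverse:
  fixes x :: "'a::{real_normed_algebra_1,banach}"
  assumes "norm x < 1"
  obtains g where "(1 - x) * g = 1" "g * (1 - x) = 1" "norm g \<le> 1 / (1 - norm x)"
proof -
  define g where "g = (\<Sum>m. x ^ m)"
  have sm: "summable (\<lambda>m. x ^ m)"
    using assms by (rule complete_algebra_summable_geometric)
  have head: "(\<Sum>m. x ^ Suc m) = g - 1"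
    using suminf_split_head[OF sm] by (simp add: g_def)
  have "(\<Sum>m. x * x ^ m) = x * g"
    unfolding g_def by (rule suminf_mult[OF sm])
  with head have xg: "x * g = g - 1" by simp
  have "(\<Sum>m. x ^ m * x) = g * x"
    unfolding g_def by (rule suminf_mult2[OF sm, symmetric])
  with head have gx: "g * x = g - 1" by (simp add: power_commutes)
  \<comment> \<open>The fixed-point equation g = 1 + x g bounds \<open>norm g\<close> without a
    termwise estimate of the series.\<close>
  have "norm g = norm (1 + x * g)" using xg by simp
  also have "\<dots> \<le> 1 + norm x * norm g"
    by (rule order_trans[OF norm_triangle_ineq]) (simp add: norm_mult_ineq)
  finally have "norm g \<le> 1 / (1 - norm x)"
    using assms by (simp add: field_simps)
  moreover have "(1 - x) * g = 1" "g * (1 - x) = 1"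
    using xg gx by (simp_all add: left_diff_distrib right_diff_distrib)
  ultimately show thesis using that by blast
qed

lemma star_zero [simp]: "star (0::'a::unital_cstar_algebra) = 0"
  using star_add[of 0 "0::'a"] by simp

lemma star_minus: "star (- x) = - star (x::'a::unital_cstar_algebra)"
  using star_add[of x "- x"] by (simp add: eq_neg_iff_add_eq_0 add.commute)

lemma star_diff: "star (x - y) = star x - star (y::'a::unital_cstar_algebra)"
  using star_add[of x "- y"] by (simp add: star_minus)

lemma star_one [simp]: "star (1::'a::unital_cstar_algebra) = 1"
  using star_mult[of "star 1" "1::'a"] by (simp add: star_star)

lemma norm_star [simp]: "norm (star x) = norm (x::'a::unital_cstar_algebra)"
proof -
  have le: "norm y \<le> norm (star y)" for y :: 'a
  proof (cases "y = 0")
    case False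
    have "norm y * norm y \<le> norm (star y) * norm y"
      using cstar_identity[of y] norm_mult_ineq[of "star y" y] by (simp add: power2_eq_square)
    with False show ?thesis by simp
  qed simp
  show ?thesis using le[of x] le[of "star x"] by (simp add: star_star)
qed

lemma is_projectionD:
  assumes "is_projection p"
  shows "star p = p" "p * p = p" "p * (p * y) = p * y"
  using assms by (simp_all add: is_projection_def flip: mult.assoc)

lemma projection_norm_le_1:
  assumes "is_projection p"
  shows "norm p \<le> 1"
proof -
  have "norm p * norm p = norm p"
    using cstar_identity[of p] is_projectionD[OF assms] by (simp add: power2_eq_square)
  then show ?thesis by auto
qed

lemma projection_complement:
  assumes "is_projection p"
  shows "is_projection (1 - p)"
  using is_projectionD[OF assms] by (simp add: is_projection_def star_diff algebra_simps)

text \<open>This is the C*-identity for \<open>p * y\<close>. It expresses squared overlaps as norms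
  of elements that are additive in \<open>p\<close>.\<close>

lemma norm_projection_sandwich:
  assumes "is_projection p"
  shows "norm (star y * p * y) = (norm (p * y))\<^sup>2"
  using cstar_identity[of "p * y"] is_projectionD[OF assms]
  by (simp add: star_mult mult.assoc)

lemma projection_mult_norm_commute:
  assumes "is_projection p" "is_projection q"
  shows "norm (p * q) = norm (q * p)"
  using norm_star[of "p * q"] is_projectionD(1)[OF assms(1)] is_projectionD(1)[OF assms(2)]
  by (simp add: star_mult)

lemma norm_sandwich_le:
  fixes g y :: "'a::unital_cstar_algebra"
  shows "norm (star y * g * y) \<le> (norm y)\<^sup>2 * norm g"
proof -
  have "norm (star y * g * y) \<le> norm (star y * g) * norm y"
    by (rule norm_mult_ineq)
  also have "\<dots> \<le> (norm (star y) * norm g) * norm y"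
    by (intro mult_right_mono norm_mult_ineq) simp
  finally show ?thesis by (simp add: power2_eq_square mult_ac)
qed

text \<open>With A = (1 - R) P, A* A = P (1 - x), so P' is the familiar range projection A (A*
  A)^(-1) A*, the inverse being taken in the corner of P. The last estimate serves twice: y = 1 - P
  yields the distance bound, and y a later projection yields its overlap with P'.\<close>

lemma orthogonalization_step:
  fixes R P :: "'a::unital_cstar_algebra"
  assumes R: "is_projection R" and P: "is_projection P"
    and s: "(norm (R * P))\<^sup>2 \<le> s" "s < 1"
  obtains P' where "is_projection P'" "R * P' = 0"
    "(norm (P - P'))\<^sup>2 \<le> s + s / (1 - s)"
    "\<And>y. (norm (P' * y))\<^sup>2 \<le> (norm (P * (1 - R) * y))\<^sup>2 / (1 - s)"
proof -
  define x where "x = P * R * P"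
  define q where "q = 1 - R"
  note RD = is_projectionD[OF R] and PD = is_projectionD[OF P]
  have q: "is_projection q"
    unfolding q_def by (rule projection_complement[OF R])
  note qD = is_projectionD[OF q]
  have nx: "norm x \<le> s"
    using s(1) norm_projection_sandwich[OF R, of P] PD(1) by (simp add: x_def)
  have s0: "0 \<le> s" using nx norm_ge_zero[of x] by linarith
  have "norm x < 1" using nx s(2) by simp
  then obtain g where g: "(1 - x) * g = 1" "norm g \<le> 1 / (1 - norm x)"
    by (rule neumann_inverse)
  have "1 / (1 - norm x) \<le> 1 / (1 - s)"
    using nx s(2) by (intro divide_left_mono) auto
  with g(2) have ng: "norm g \<le> 1 / (1 - s)" by simp
  have xs: "star x = x"
    by (simp add: x_def star_mult RD PD mult.assoc)
  \<comment> \<open>Since 1 - x is self-adjoint, \<open>star g\<close> is a left inverse of it, and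
    a left inverse equals the right inverse \<open>g\<close>.\<close>
  have inv_unique: "g' = g" if "g' * (1 - x) = 1" for g'
    using that g(1) by (metis mult.assoc mult_1_left mult_1_right)
  have gs: "star g = g"
    using arg_cong[OF g(1), of star] by (intro inv_unique) (simp add: star_mult star_diff xs)
  have a: "P * q * P = P * (1 - x)"
    by (simp add: q_def x_def algebra_simps PD)
  define P' where "P' = q * P * g * P * q"
  have st: "star P' = P'"
    by (simp add: P'_def star_mult qD PD gs mult.assoc)
  \<comment> \<open>This cancellation collapses the middle of both \<open>P' * P'\<close> and
    \<open>P * P' * P\<close>.\<close>
  have core: "P * q * P * g = P"
    unfolding a by (simp only: mult.assoc g(1) mult_1_right)
  have idem: "P' * P' = P'"
  proof -
    have "P' * P' = q * P * g * (P * (q * q) * P * g) * P * q"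
      by (simp only: P'_def mult.assoc)
    also have "\<dots> = P'"
      by (simp only: qD(2) core) (simp add: P'_def mult.assoc PD)
    finally show ?thesis .
  qed
  have proj: "is_projection P'" using st idem by (simp add: is_projection_def)
  have "R * q = 0" by (simp add: q_def algebra_simps RD)
  then have orth: "R * P' = 0" by (simp add: P'_def flip: mult.assoc)
  have est: "(norm (P' * y))\<^sup>2 \<le> (norm (P * q * y))\<^sup>2 / (1 - s)" for y
  proof -
    have "(norm (P' * y))\<^sup>2 = norm (star y * P' * y)"
      by (rule norm_projection_sandwich[OF proj, symmetric])
    also have "star y * P' * y = star (P * q * y) * g * (P * q * y)"
      by (simp add: P'_def star_mult qD PD mult.assoc)
    also have "norm \<dots> \<le> (norm (P * q * y))\<^sup>2 * norm g"
      by (rule norm_sandwich_le)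
    also have "\<dots> \<le> (norm (P * q * y))\<^sup>2 * (1 / (1 - s))"
      by (intro mult_left_mono ng) simp
    finally show ?thesis by simp
  qed
  have PP'P: "P * P' * P = P - x"
  proof -
    have "P * P' * P = (P * q * P * g) * (P * q * P)"
      by (simp only: P'_def mult.assoc)
    also have "\<dots> = P - x"
      by (simp only: core) (simp add: q_def x_def algebra_simps PD)
    finally show ?thesis .
  qed
  have Pc: "is_projection (1 - P)" by (rule projection_complement[OF P])
  \<comment> \<open>As P (1 - P) = 0, only the R-part of q = 1 - R survives.\<close>
  have small: "norm (P * q * (1 - P)) \<le> norm (R * P)"
  proof -
    have "P * q * (1 - P) = - (P * R * (1 - P))"
      by (simp add: q_def algebra_simps PD)
    then have "norm (P * q * (1 - P)) \<le> norm (P * R) * norm (1 - P)"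
      by (simp add: norm_mult_ineq)
    also have "\<dots> \<le> norm (P * R) * 1"
      by (intro mult_left_mono projection_norm_le_1[OF Pc] norm_ge_zero)
    finally show ?thesis
      by (simp add: projection_mult_norm_commute[OF P R])
  qed
  have "(norm (P - P'))\<^sup>2 = norm ((P - P') * (P - P'))"
    using cstar_identity[of "P - P'"] by (simp add: star_diff st PD)
  \<comment> \<open>The square of a difference of projections commutes with both, so it is the sum
    of its corners at P and 1 - P; the first is P - P P' P = x.\<close>
  also have "(P - P') * (P - P') = x + (1 - P) * P' * (1 - P)"
  proof -
    have "P * (P' * P) = P - x" using PP'P by (simp add: mult.assoc)
    then show ?thesis by (simp add: algebra_simps idem PD)
  qed
  also have "norm \<dots> \<le> norm x + norm ((1 - P) * P' * (1 - P))"
    by (rule norm_triangle_ineq)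
  also have "norm ((1 - P) * P' * (1 - P)) = (norm (P' * (1 - P)))\<^sup>2"
    using norm_projection_sandwich[OF proj, of "1 - P"] by (simp add: star_diff PD)
  also have "\<dots> \<le> (norm (P * q * (1 - P)))\<^sup>2 / (1 - s)" by (rule est)
  also have "\<dots> \<le> (norm (R * P))\<^sup>2 / (1 - s)"
    using small s(2) by (intro divide_right_mono power_mono) auto
  finally have "(norm (P - P'))\<^sup>2 \<le> norm x + (norm (R * P))\<^sup>2 / (1 - s)"
    by simp
  also have "\<dots> \<le> s + s / (1 - s)"
    using nx s by (intro add_mono divide_right_mono) auto
  finally show thesis
    using that[OF proj orth] est by (simp add: q_def)
qed

text \<open>Let D and E be the old and new denominators. Both \<delta> + s = \<delta> (1 + \<delta>)
  / D and 1 - s = E (1 + \<delta>) / D carry the factor (1 + \<delta>) / D, and k E + (1 + \<delta>)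
  = (k + 1) D cancels D from the sum. The bound on k \<delta> says E > 0.\<close>

lemma overlap_recursion:
  fixes \<delta> k :: real
  defines "s \<equiv> k * \<delta>\<^sup>2 / (1 + \<delta> - k * \<delta>)"
  assumes "0 < \<delta>" "k * \<delta> < 1"
  shows "s + (\<delta> + s)\<^sup>2 / (1 - s) = (k + 1) * \<delta>\<^sup>2 / (1 + \<delta> - (k + 1) * \<delta>)"
proof -
  define D where "D = 1 + \<delta> - k * \<delta>"
  define E where "E = 1 - k * \<delta>"
  have pos: "D > 0" "E > 0" "1 + \<delta> > 0" using assms by (simp_all add: D_def E_def)
  have 1: "\<delta> + s = \<delta> * (1 + \<delta>) / D"
    using pos by (simp add: s_def flip: D_def) (simp add: D_def field_simps power2_eq_square)
  have 2: "1 - s = E * (1 + \<delta>) / D"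
    using pos by (simp add: s_def flip: D_def) (simp add: D_def E_def field_simps power2_eq_square)
  have "(\<delta> + s)\<^sup>2 / (1 - s) = \<delta>\<^sup>2 * (1 + \<delta>) / (D * E)"
    unfolding 1 2 using pos by (simp add: power2_eq_square divide_simps)
  moreover have "s = k * \<delta>\<^sup>2 / D" by (simp add: s_def D_def)
  ultimately have "s + (\<delta> + s)\<^sup>2 / (1 - s) = k * \<delta>\<^sup>2 / D + \<delta>\<^sup>2 * (1 + \<delta>) / (D * E)"
    by linarith
  also have "\<dots> = \<delta>\<^sup>2 * (k * E + (1 + \<delta>)) / (D * E)"
    using pos by (simp add: field_simps)
  also have "k * E + (1 + \<delta>) = (k + 1) * D" by (simp add: D_def E_def algebra_simps)
  also have "\<delta>\<^sup>2 * ((k + 1) * D) / (D * E) = (k + 1) * \<delta>\<^sup>2 / E"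
    using pos by (simp add: field_simps)
  also have "E = 1 + \<delta> - (k + 1) * \<delta>" by (simp add: E_def algebra_simps)
  finally show ?thesis .
qed

text \<open>Here m plays the role of n - 1. Bounding k \<delta> by m \<delta> = \<epsilon> / 2 above
  and below the fraction bar leaves \<delta> \<le> (\<epsilon> / 2) (1 + \<delta> - \<epsilon> / 2);
  divided by \<delta>, this is (m - 1) (1 - \<epsilon> / 2) \<ge> 0.\<close>

lemma overlap_bound:
  fixes \<epsilon> \<delta> k m :: real
  assumes "0 < \<epsilon>" "\<epsilon> < 1" "1 \<le> m" "0 \<le> k" "k \<le> m" and \<delta>: "\<delta> = \<epsilon> / (2 * m)"
  shows "k * \<delta>\<^sup>2 / (1 + \<delta> - k * \<delta>) \<le> \<epsilon>\<^sup>2 / 4"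
proof -
  have pos: "\<delta> > 0" using assms by simp
  have m: "m * \<delta> = \<epsilon> / 2" using assms by simp
  have k: "k * \<delta> \<le> \<epsilon> / 2" using mult_right_mono[OF \<open>k \<le> m\<close>, of \<delta>] m pos by simp
  have "(m - 1) * \<epsilon> \<le> (m - 1) * 1" using assms by (intro mult_left_mono) auto
  then have "1 \<le> m + \<epsilon> / 2 - m * (\<epsilon> / 2)" using assms by (simp add: algebra_simps)
  then have "\<delta> * 1 \<le> \<delta> * (m + \<epsilon> / 2 - m * (\<epsilon> / 2))" using pos by (intro mult_left_mono) auto
  also have "\<dots> = (\<epsilon> / 2) * (1 + \<delta> - \<epsilon> / 2)"
    by (simp add: algebra_simps flip: m)
  also have "\<dots> \<le> (\<epsilon> / 2) * (1 + \<delta> - k * \<delta>)"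
    using k assms by (intro mult_left_mono) auto
  finally have "(\<epsilon> / 2) * \<delta> \<le> (\<epsilon> / 2) * ((\<epsilon> / 2) * (1 + \<delta> - k * \<delta>))"
    using assms by (intro mult_left_mono) auto
  moreover have "k * \<delta> * \<delta> \<le> (\<epsilon> / 2) * \<delta>" using k pos by (intro mult_right_mono) auto
  ultimately have "k * \<delta>\<^sup>2 \<le> \<epsilon>\<^sup>2 / 4 * (1 + \<delta> - k * \<delta>)"
    by (simp add: power2_eq_square algebra_simps)
  then show ?thesis using k pos assms(1,2) by (subst pos_divide_le_eq) auto
qed

theorem corollary3p8:
  fixes P :: "nat \<Rightarrow> 'a::unital_cstar_algebra" and n :: nat and \<epsilon> :: real
  assumes "n \<ge> 2"
    and "\<forall>i\<in>{1..n}. nontrivial_projection (P i)"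
    and "0 < \<epsilon>" and "\<epsilon> < 1"
    and "\<forall>i\<in>{1..n}. \<forall>j\<in>{1..n}. i < j \<longrightarrow> norm (P i * P j) < \<epsilon> / (2 * (real n - 1))"
  shows "\<exists>P' :: nat \<Rightarrow> 'a.
           (\<forall>i\<in>{1..n}. is_projection (P' i)) \<and>
           mutually_orthogonal {1..n} P' \<and>
           (\<forall>i\<in>{1..n}. norm (P i - P' i) < \<epsilon>)"
proof -
  define \<delta> where "\<delta> = \<epsilon> / (2 * (real n - 1))"
  define s where "s k = real k * \<delta>\<^sup>2 / (1 + \<delta> - real k * \<delta>)" for k :: nat
  have \<delta>: "0 < \<delta>" using assms by (simp add: \<delta>_def)
  have proj: "is_projection (P i)" if "i \<in> {1..n}" for i
    using assms(2) that by (simp add: nontrivial_projection_def)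
  \<comment> \<open>The bound stops at k = n - 1: after the last step no projection is left to
    overlap with.\<close>
  have s_le: "s k \<le> \<epsilon>\<^sup>2 / 4" if "k < n" for k
    unfolding s_def using assms that by (intro overlap_bound[of _ "real n - 1"]) (auto simp: \<delta>_def)
  have s_Suc: "s k + (\<delta> + s k)\<^sup>2 / (1 - s k) = s (Suc k)" if "k < n" for k
  proof -
    have "real k * \<delta> \<le> (real n - 1) * \<delta>" using that \<delta> by (intro mult_right_mono) auto
    also have "\<dots> = \<epsilon> / 2" using assms(1) by (simp add: \<delta>_def field_simps)
    finally have "real k * \<delta> < 1" using assms by simp
    then show ?thesis using overlap_recursion[OF \<delta>, of "real k"] by (simp add: s_def add.commute)
  qed
  \<comment> \<open>Instead of fixing R as the sum of the Q i, the invariant keeps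
    \<open>Q i * R = Q i\<close>, that is, Q i lies below R. Then R P' = 0 forces Q i P' = Q i R P'
    = 0.\<close>
  have "\<exists>Q R. (\<forall>i\<in>{1..k}. is_projection (Q i)) \<and> mutually_orthogonal {1..k} Q \<and>
           (\<forall>i\<in>{1..k}. norm (P i - Q i) < \<epsilon>) \<and> is_projection R \<and>
           (\<forall>i\<in>{1..k}. Q i * R = Q i) \<and> (\<forall>j\<in>{k<..n}. (norm (R * P j))\<^sup>2 \<le> s k)"
    if "k \<le> n" for k
    using that
  proof (induction k)
    case 0
    \<comment> \<open>The index range of Q is empty, and R = 0 has overlap exactly
      \<open>s 0 = 0\<close>.\<close>
    show ?case
      by (intro exI[of _ "\<lambda>_. 0"] exI[of _ 0])
        (simp add: mutually_orthogonal_def is_projection_def s_def)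
  next
    case (Suc k)
    from Suc.IH[OF Suc_leD[OF Suc.prems]] obtain Q R where Q: "\<And>i. i \<in> {1..k} \<Longrightarrow> is_projection (Q i)"
      and orth: "mutually_orthogonal {1..k} Q"
      and close: "\<And>i. i \<in> {1..k} \<Longrightarrow> norm (P i - Q i) < \<epsilon>"
      and R: "is_projection R" and QR: "\<And>i. i \<in> {1..k} \<Longrightarrow> Q i * R = Q i"
      and RP: "\<And>j. j \<in> {k<..n} \<Longrightarrow> (norm (R * P j))\<^sup>2 \<le> s k"
      by blast
    note RD = is_projectionD[OF R]
    let ?p = "P (Suc k)"
    have p: "is_projection ?p" using Suc.prems by (intro proj) simp
    have RPp: "(norm (R * ?p))\<^sup>2 \<le> s k" using Suc.prems by (intro RP) simp
    have "\<epsilon>\<^sup>2 < 1" using assms(3,4) by (simp add: power_less_one_iff)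
    with s_le[of k] Suc.prems have s4: "s k \<le> \<epsilon>\<^sup>2 / 4" "s k < 1 / 4" by auto
    have s0: "0 \<le> s k" using RPp zero_le_power2[of "norm (R * ?p)"] by linarith
    obtain P' where P': "is_projection P'" "R * P' = 0"
      and cl: "(norm (?p - P'))\<^sup>2 \<le> s k + s k / (1 - s k)"
      and ov: "\<And>y. (norm (P' * y))\<^sup>2 \<le> (norm (?p * (1 - R) * y))\<^sup>2 / (1 - s k)"
      using orthogonalization_step[OF R p RPp] s4(2) by auto
    have P'R: "P' * R = 0"
      using arg_cong[OF P'(2), of star] by (simp add: star_mult RD is_projectionD[OF P'(1)])
    \<comment> \<open>Since s k < 1/4, the squared distance is at most 3 s k \<le> 3 \<epsilon>^2 /
      4, strictly below \<epsilon>^2.\<close>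
    have "s k / (1 - s k) \<le> 2 * s k"
    proof -
      have "s k * 1 \<le> s k * (2 * (1 - s k))" using s0 s4(2) by (intro mult_left_mono) auto
      then show ?thesis using s4(2) by (simp add: pos_divide_le_eq mult_ac)
    qed
    with cl s4(1) have "(norm (?p - P'))\<^sup>2 \<le> 3 * (\<epsilon>\<^sup>2 / 4)" by linarith
    also have "\<dots> < \<epsilon>\<^sup>2" using assms(3) by simp
    finally have new_close: "norm (?p - P') < \<epsilon>"
      using assms(3) by (simp add: power2_less_imp_less)
    have QP': "Q i * P' = 0" if "i \<in> {1..k}" for i
      using QR[OF that] P'(2) by (metis mult.assoc mult_zero_right)
    have P'Q: "P' * Q i = 0" if "i \<in> {1..k}" for i
      using arg_cong[OF QP'[OF that], of star] is_projectionD(1)[OF Q[OF that]]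
        is_projectionD(1)[OF P'(1)] by (simp add: star_mult)
    have R': "is_projection (R + P')"
      using P'(2) P'R RD is_projectionD[OF P'(1)]
      by (simp add: is_projection_def star_add algebra_simps)
    have new_overlap: "(norm ((R + P') * P j))\<^sup>2 \<le> s (Suc k)" if j: "j \<in> {Suc k<..n}" for j
    proof -
      have pj: "is_projection (P j)" using j by (intro proj) simp
      note pjD = is_projectionD[OF pj]
      have RPj: "(norm (R * P j))\<^sup>2 \<le> s k" using j by (intro RP) simp
      \<comment> \<open>Writing R = R R splits the correction into two overlaps with R, each at most
        sqrt (s k), so their product costs only s k.\<close>
      have "norm (?p * (1 - R) * P j) = norm (?p * P j - (?p * R) * (R * P j))"
        by (simp add: algebra_simps RD)
      also have "\<dots> \<le> norm (?p * P j) + norm (?p * R) * norm (R * P j)"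
        using norm_triangle_ineq4 norm_mult_ineq by (meson add_left_mono order_trans)
      also have "norm (?p * P j) \<le> \<delta>"
        using assms(5) j by (force simp: \<delta>_def intro: less_imp_le)
      also have "norm (?p * R) = norm (R * ?p)" by (rule projection_mult_norm_commute[OF p R])
      also have "norm (R * ?p) * norm (R * P j) \<le> sqrt (s k) * sqrt (s k)"
        using RPp RPj s0 by (intro mult_mono real_le_rsqrt) auto
      finally have "norm (?p * (1 - R) * P j) \<le> \<delta> + s k" using s0 by simp
      then have "(norm (?p * (1 - R) * P j))\<^sup>2 / (1 - s k) \<le> (\<delta> + s k)\<^sup>2 / (1 - s k)"
        using s4(2) by (intro divide_right_mono power_mono) auto
      with ov[of "P j"] have P'Pj: "(norm (P' * P j))\<^sup>2 \<le> (\<delta> + s k)\<^sup>2 / (1 - s k)" by linarith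
      \<comment> \<open>Compressing R + P' by P j makes the squared overlaps subadditive, which is
        why the recursion tracks squares.\<close>
      have "(norm ((R + P') * P j))\<^sup>2 = norm (P j * R * P j + P j * P' * P j)"
        using norm_projection_sandwich[OF R', of "P j"] by (simp add: pjD algebra_simps)
      also have "\<dots> \<le> norm (P j * R * P j) + norm (P j * P' * P j)"
        by (rule norm_triangle_ineq)
      also have "\<dots> = (norm (R * P j))\<^sup>2 + (norm (P' * P j))\<^sup>2"
        using norm_projection_sandwich[OF R, of "P j"] norm_projection_sandwich[OF P'(1), of "P j"]
        by (simp add: pjD)
      also have "\<dots> \<le> s k + (\<delta> + s k)\<^sup>2 / (1 - s k)" using RPj P'Pj by linarith
      also have "\<dots> = s (Suc k)" using Suc.prems by (intro s_Suc) simp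
      finally show ?thesis .
    qed
    have split: "i \<in> {1..k} \<or> i = Suc k" if "i \<in> {1..Suc k}" for i using that by auto
    define Q' where "Q' = Q(Suc k := P')"
    have Q'_old: "Q' i = Q i" if "i \<in> {1..k}" for i using that by (simp add: Q'_def)
    have Q'_new: "Q' (Suc k) = P'" by (simp add: Q'_def)
    have "is_projection (Q' i)" "norm (P i - Q' i) < \<epsilon>" "Q' i * (R + P') = Q' i"
      if "i \<in> {1..Suc k}" for i
      using split[OF that] Q P'(1) close new_close QR QP' P'R is_projectionD(2)[OF P'(1)]
      by (auto simp: Q'_old Q'_new distrib_left)
    moreover have "mutually_orthogonal {1..Suc k} Q'"
      unfolding mutually_orthogonal_def
    proof (intro ballI impI)
      fix i j assume "i \<in> {1..Suc k}" "j \<in> {1..Suc k}" "i \<noteq> j"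
      then show "Q' i * Q' j = 0"
        using split[of i] split[of j] orth QP' P'Q
        by (auto simp: Q'_old Q'_new mutually_orthogonal_def)
    qed
    ultimately show ?case using R' new_overlap by blast
  qed
  from this[of n] show ?thesis by blast
qed

end
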